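(* Let $n\ge 2$ be an integer and let $\epsilon>0$. Then for every $\delta>0$ there exists a symmetric function $g:\mathbb{R}^n\to\mathbb{R}$ such that $$\left|g(x_1,\dots,x_{n-1},x_n+x_{n+1})-g(x_1,\dots,x_{n-1},x_n)-g(x_1,\dots,x_{n-1},x_{n+1})\right|\le \epsilon\,|x_1|\cdots|x_{n-1}|\,\left(|x_n|+|x_{n+1}|\right)$$ for all $x_1,\dots,x_{n+1}\in\mathbb{R}$, but for which there does not exist a symmetric and $n$-additive mapping $a:\mathbb{R}^n\to\mathbb{R}$ satisfying $$\left|g(x_1,\dots,x_n)-a(x_1,\dots,x_n)\right|\le \delta\,|x_1|\cdots|x_n|\quad\text{for all } x_1,\dots,x_n\in\mathbb{R}.$$
   Context: A function $g:\mathbb{R}^n\to\mathbb{R}$ is symmetric if its value is unchanged under every permutation of its $n$ arguments. A function $a:\mathbb{R}^n\to\mathbb{R}$ is $n$-additive if it is additive in each of its $n$ variables separately when the other variables are held fixed (no continuity or $\mathbb{R}$-linearity is assumed). *)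

theory Defs
  imports Complex_Main "HOL-Combinatorics.Permutations"
begin

text \<open>
  A function from \<open>\<real>\<^sup>n\<close> to \<open>\<real>\<close> is modelled as a function on real lists, of which only the
  values on lists of length \<open>n\<close> matter; all conditions below are restricted to such lists.
\<close>

definition symmetric_fun :: "nat \<Rightarrow> (real list \<Rightarrow> real) \<Rightarrow> bool" where
  "symmetric_fun n g \<longleftrightarrow>
     (\<forall>p xs. p permutes {..<n} \<and> length xs = n \<longrightarrow> g (permute_list p xs) = g xs)"

definition multi_additive :: "nat \<Rightarrow> (real list \<Rightarrow> real) \<Rightarrow> bool" where
  "multi_additive n a \<longleftrightarrow>
     (\<forall>i<n. \<forall>xs u v. length xs = n \<longrightarrow> a (xs[i := u + v]) = a (xs[i := u]) + a (xs[i := v]))"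

end

theory Submission
  imports Defs
begin

text \<open>
  The function \<open>x ln |x|\<close> is additive up to an error of at most \<open>|u| + |v|\<close>, so
  \<open>g xs = \<epsilon> P ln |P|\<close> with \<open>P\<close> the product of \<open>xs\<close> satisfies the required bound: apply the
  one-variable estimate to \<open>Q u\<close> and \<open>Q v\<close>, where \<open>Q\<close> is the product of the fixed arguments.
  An approximating \<open>n\<close>-additive map, restricted to the points \<open>(m, 1, \<dots>, 1)\<close> with \<open>m\<close> a natural
  number, would be linear in \<open>m\<close>, which forces \<open>ln m\<close> to be bounded.
\<close>

text \<open>For positive \<open>p\<close>, \<open>q\<close> the middle term equals p ln(1 + q/p) + q
  ln(1 + p/q). Since 0 \<le> ln(1 + t) \<le> t for t > 0, the two summands lie in [0, q] and
  [0, p].\<close>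

lemma xlnx_superadditive_bounds:
  fixes p q :: real
  assumes "p \<ge> 0" "q \<ge> 0"
  shows "0 \<le> (p + q) * ln (p + q) - p * ln p - q * ln q"
    and "(p + q) * ln (p + q) - p * ln p - q * ln q \<le> p + q"
proof -
  have "0 \<le> (p + q) * ln (p + q) - p * ln p - q * ln q \<and>
        (p + q) * ln (p + q) - p * ln p - q * ln q \<le> p + q"
  \<comment> \<open>If one argument is 0, the difference vanishes because
    \<open>0 * ln 0 = 0\<close>; otherwise division by \<open>p\<close> and \<open>q\<close> is
    allowed.\<close>
  proof (cases "p = 0 \<or> q = 0")
    case True
    then show ?thesis using assms by auto
  next
    case False
    then have pos: "p > 0" "q > 0" using assms by auto
    have lower: "0 \<le> x * (ln (x + y) - ln x)" and upper: "x * (ln (x + y) - ln x) \<le> y"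
      if "x > 0" "y > 0" for x y :: real
    proof -
      show "0 \<le> x * (ln (x + y) - ln x)" using that by simp
      \<comment> \<open>The concave \<open>ln\<close> lies below its tangent at
        \<open>x\<close>.\<close>
      have "ln (x + y) - ln x \<le> (x + y - x) / x"
        using that by (intro ln_diff_le) auto
      then show "x * (ln (x + y) - ln x) \<le> y" using that by (simp add: field_simps)
    qed
    have "(p + q) * ln (p + q) - p * ln p - q * ln q
        = p * (ln (p + q) - ln p) + q * (ln (q + p) - ln q)"
      by (simp add: algebra_simps)
    then show ?thesis
      using lower[of p q] lower[of q p] upper[of p q] upper[of q p] pos by linarith
  qed
  then show "0 \<le> (p + q) * ln (p + q) - p * ln p - q * ln q"
    and "(p + q) * ln (p + q) - p * ln p - q * ln q \<le> p + q" by auto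
qed

text \<open>Oddness of x ln |x| reduces every combination of signs to the case of two nonnegative
  arguments.\<close>

lemma xlnx_approx_additive:
  fixes u v :: real
  shows "\<bar>(u + v) * ln \<bar>u + v\<bar> - u * ln \<bar>u\<bar> - v * ln \<bar>v\<bar>\<bar> \<le> \<bar>u\<bar> + \<bar>v\<bar>"
proof -
  define f where "f x = x * ln \<bar>x\<bar>" for x :: real
  have odd: "f (- x) = - f x" for x by (simp add: f_def)
  have pos: "\<bar>f (p + q) - f p - f q\<bar> \<le> p + q" if "p \<ge> 0" "q \<ge> 0" for p q
    using xlnx_superadditive_bounds[OF that] that by (simp add: f_def)
  have *: "\<bar>f (x + y) - f x - f y\<bar> \<le> \<bar>x\<bar> + \<bar>y\<bar>" if "x + y \<ge> 0" for x y
  proof -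
    consider "x \<ge> 0" "y \<ge> 0" | "x \<ge> 0" "y < 0" | "x < 0" "y \<ge> 0"
      using \<open>x + y \<ge> 0\<close> by linarith
    then show ?thesis
    proof cases
      case 1
      then show ?thesis using pos[of x y] by simp
    next
      case 2
      \<comment> \<open>Rewrite the sum as x = (x + y) + (-y) with nonnegative summands. By oddness
        the defect only changes sign, and the bound becomes x \<le> |x| + |y|.\<close>
      then show ?thesis using pos[of "x + y" "- y"] that odd[of y] by simp
    next
      case 3
      then show ?thesis using pos[of "x + y" "- x"] that odd[of x] by simp
    qed
  qed
  have "\<bar>f (u + v) - f u - f v\<bar> \<le> \<bar>u\<bar> + \<bar>v\<bar>"
  proof (cases "u + v \<ge> 0")
    case True
    then show ?thesis by (rule *)
  next
    case False
    \<comment> \<open>Negating both arguments makes the sum positive and preserves the absolute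
      defect.\<close>
    have "- u + - v = - (u + v)" by simp
    then show ?thesis
      using *[of "- u" "- v"] False odd[of u] odd[of v] odd[of "u + v"] by simp
  qed
  then show ?thesis by (simp add: f_def)
qed

lemma abs_prod_list: "\<bar>prod_list xs\<bar> = (\<Prod>x\<leftarrow>xs. \<bar>x\<bar>)" for xs :: "'a :: linordered_idom list"
  by (induction xs) (simp_all add: abs_mult)

lemma prod_list_permute_list:
  fixes xs :: "'a :: comm_monoid_mult list"
  assumes "p permutes {..<length xs}"
  shows "prod_list (permute_list p xs) = prod_list xs"
  by (metis assms mset_permute_list prod_mset_prod_list)

lemma additive_of_nat:
  fixes A :: "'a :: semiring_1 \<Rightarrow> 'b :: ring_1"
  assumes add: "\<And>u v. A (u + v) = A u + A v"
  shows "A (of_nat m) = of_nat m * A 1"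
proof (induction m)
  case 0
  show ?case using add[of 0 0] by simp
next
  case (Suc m)
  then show ?case using add[of 1 "of_nat m"] by (simp add: algebra_simps)
qed

theorem mainTheorem1:
  fixes n :: nat and \<epsilon> :: real
  assumes "n \<ge> 2" and "\<epsilon> > 0"
  shows "\<forall>\<delta>::real. \<delta> > 0 \<longrightarrow>
    (\<exists>g :: real list \<Rightarrow> real. symmetric_fun n g \<and>
       (\<forall>xs u v. length xs = n - 1 \<longrightarrow>
          \<bar>g (xs @ [u + v]) - g (xs @ [u]) - g (xs @ [v])\<bar>
            \<le> \<epsilon> * (\<Prod>x\<leftarrow>xs. \<bar>x\<bar>) * (\<bar>u\<bar> + \<bar>v\<bar>)) \<and>
       \<not> (\<exists>a :: real list \<Rightarrow> real. symmetric_fun n a \<and> multi_additive n a \<and>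
            (\<forall>xs. length xs = n \<longrightarrow> \<bar>g xs - a xs\<bar> \<le> \<delta> * (\<Prod>x\<leftarrow>xs. \<bar>x\<bar>))))"
proof (intro allI impI)
  fix \<delta> :: real
  assume "\<delta> > 0"
  \<comment> \<open>The factor \<open>\<epsilon>\<close> scales the error constant 1 of x ln |x|.
    The same \<open>g\<close> serves for every \<open>\<delta>\<close>.\<close>
  define g :: "real list \<Rightarrow> real" where "g xs = \<epsilon> * (prod_list xs * ln \<bar>prod_list xs\<bar>)" for xs
  have "symmetric_fun n g"
    by (auto simp: symmetric_fun_def g_def prod_list_permute_list)
  moreover have "\<bar>g (xs @ [u + v]) - g (xs @ [u]) - g (xs @ [v])\<bar>
      \<le> \<epsilon> * (\<Prod>x\<leftarrow>xs. \<bar>x\<bar>) * (\<bar>u\<bar> + \<bar>v\<bar>)" for xs u v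
  proof -
    define U V where "U = prod_list xs * u" and "V = prod_list xs * v"
    have "g (xs @ [u + v]) - g (xs @ [u]) - g (xs @ [v])
        = \<epsilon> * ((U + V) * ln \<bar>U + V\<bar> - U * ln \<bar>U\<bar> - V * ln \<bar>V\<bar>)"
      by (simp add: g_def U_def V_def right_diff_distrib flip: distrib_left)
    then have "\<bar>g (xs @ [u + v]) - g (xs @ [u]) - g (xs @ [v])\<bar> \<le> \<epsilon> * (\<bar>U\<bar> + \<bar>V\<bar>)"
      using xlnx_approx_additive[of U V] \<open>\<epsilon> > 0\<close> by (simp add: abs_mult)
    also have "\<dots> = \<epsilon> * (\<Prod>x\<leftarrow>xs. \<bar>x\<bar>) * (\<bar>u\<bar> + \<bar>v\<bar>)"
      by (simp add: U_def V_def abs_mult abs_prod_list distrib_left mult.assoc)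
    finally show ?thesis .
  qed
  moreover have False
    if add: "multi_additive n a"
      and close: "\<And>xs. length xs = n \<Longrightarrow> \<bar>g xs - a xs\<bar> \<le> \<delta> * (\<Prod>x\<leftarrow>xs. \<bar>x\<bar>)"
    for a :: "real list \<Rightarrow> real"
  proof -
    define point where "point x = (replicate n 1)[0 := x]" for x :: real
    \<comment> \<open>Slot 0 must exist for the list update in \<open>point\<close> to take
      effect.\<close>
    obtain k where k: "n = Suc k" using \<open>n \<ge> 2\<close> by (cases n) auto
    have point: "length (point x) = n" "prod_list (point x) = x" for x
      by (simp_all add: point_def k)
    define A where "A x = a (point x)" for x
    have A_add: "A (u + v) = A u + A v" for u v
      using add k unfolding multi_additive_def A_def point_def by (metis length_replicate zero_less_Suc)
    have ln_bound: "\<epsilon> * ln (real m) \<le> \<delta> + A 1" if "m > 0" for m :: nat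
    proof -
      have "\<bar>\<epsilon> * (real m * ln (real m)) - real m * A 1\<bar> \<le> \<delta> * real m"
        using close[OF point(1), of "real m"] additive_of_nat[of A m, OF A_add]
        by (simp add: g_def A_def point flip: abs_prod_list)
      \<comment> \<open>Linearity of \<open>A\<close> on the naturals gives every term a factor
        \<open>m\<close>; cancelling it leaves a bound on \<open>ln m\<close> independent of
        \<open>m\<close>.\<close>
      then have "real m * (\<epsilon> * ln (real m)) \<le> real m * (\<delta> + A 1)"
        by (simp add: algebra_simps abs_le_iff)
      then show ?thesis using that by simp
    qed
    \<comment> \<open>The largest value of \<open>ln m\<close> that \<open>ln_bound\<close> permits;
      any \<open>m\<close> beyond \<open>exp c\<close> violates it.\<close>
    define c where "c = (\<delta> + A 1) / \<epsilon>"
    obtain m :: nat where m: "real m > exp c" using reals_Archimedean2 by blast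
    have m0: "real m > 0" using m exp_gt_zero[of c] by linarith
    then have "c < ln (real m)" using m by (metis exp_less_cancel_iff exp_ln)
    then have "\<delta> + A 1 < \<epsilon> * ln (real m)"
      using \<open>\<epsilon> > 0\<close> by (simp add: c_def field_simps)
    then show False using ln_bound[of m] m0 by simp
  qed
  ultimately show "\<exists>g :: real list \<Rightarrow> real. symmetric_fun n g \<and>
       (\<forall>xs u v. length xs = n - 1 \<longrightarrow>
          \<bar>g (xs @ [u + v]) - g (xs @ [u]) - g (xs @ [v])\<bar>
            \<le> \<epsilon> * (\<Prod>x\<leftarrow>xs. \<bar>x\<bar>) * (\<bar>u\<bar> + \<bar>v\<bar>)) \<and>
       \<not> (\<exists>a :: real list \<Rightarrow> real. symmetric_fun n a \<and> multi_additive n a \<and>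
            (\<forall>xs. length xs = n \<longrightarrow> \<bar>g xs - a xs\<bar> \<le> \<delta> * (\<Prod>x\<leftarrow>xs. \<bar>x\<bar>)))"
    by blast
qed

end
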